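(* Let $C=\{x\in\mathbb R^n\mid x_i\ge0,\ i=1,\dots,n\}$ be the nonnegative orthant. Let $\gamma\in\mathbb R$, $h\in\mathbb R^n$, $Q_0>0$, $Q(z):=\frac12\|z\|_2^2+Q_0$, $E_{\gamma,h}(x):=-\frac{\gamma+\langle h,x\rangle}{Q(x)}$, and assume $\sup_{x\in C}E_{\gamma,h}(x)>0$. Then the problem $\sup_{x\in C}E_{\gamma,h}(x)$ is solved by $u=P_C(-e^{-1}h)$, where $$P_C(y)=(y)_+$$ and the optimal value $e=E_{\gamma,h}(u)$ is $$e=\frac{-\beta_2+\sqrt{\beta_2^2-4\beta_1\beta_3}}{2\beta_1},$$ with $$\beta_1:=Q_0,\qquad\beta_2:=\gamma,\qquad\beta_3:=\tfrac12\|(h)_-\|_2^2-\langle h,(h)_-\rangle .$$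
   Context: $P_C(y):=\operatorname{argmin}_{x\in C}\frac12\|x-y\|_2^2$ denotes the orthogonal projection onto $C$. For $y\in\mathbb R^n$, $(y)_+:=\max(y,0)$ and $(y)_-:=\min(y,0)$, both taken componentwise; $\langle\cdot,\cdot\rangle$ is the standard inner product and $\|\cdot\|_2$ the Euclidean norm. "The problem is solved by $u$" means that $u\in C$ is a maximizer of $E_{\gamma,h}$ over $C$. *)

theory Defs
  imports "HOL-Analysis.Analysis"
begin

definition nonneg_orthant :: "(real ^ 'n) set" where
  "nonneg_orthant = {x. \<forall>i. 0 \<le> x $ i}"

definition pos_part :: "real ^ 'n \<Rightarrow> real ^ 'n" where
  "pos_part y = (\<chi> i. max (y $ i) 0)"

text \<open>The negative part keeps its sign: its components are nonpositive.\<close>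

definition neg_part :: "real ^ 'n \<Rightarrow> real ^ 'n" where
  "neg_part y = (\<chi> i. min (y $ i) 0)"

definition orth_proj :: "(real ^ 'n) set \<Rightarrow> real ^ 'n \<Rightarrow> real ^ 'n" where
  "orth_proj C y = arg_min_on (\<lambda>x. 1 / 2 * (norm (x - y))\<^sup>2) C"

definition quad :: "real \<Rightarrow> real ^ 'n \<Rightarrow> real" where
  "quad Q0 z = 1 / 2 * (norm z)\<^sup>2 + Q0"

definition energy :: "real \<Rightarrow> real \<Rightarrow> real ^ 'n \<Rightarrow> real ^ 'n \<Rightarrow> real" where
  "energy Q0 \<gamma> h x = - ((\<gamma> + h \<bullet> x) / quad Q0 x)"

definition is_maximizer_on :: "('a \<Rightarrow> real) \<Rightarrow> 'a set \<Rightarrow> 'a \<Rightarrow> bool" where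
  "is_maximizer_on f C u \<longleftrightarrow> u \<in> C \<and> (\<forall>x\<in>C. f x \<le> f u)"

end

theory Submission
  imports Defs
begin

text \<open>
  Write \<open>h\<^sub>-\<close> for the negative part and \<open>N\<close> for its squared norm.  The decomposition of \<open>h\<close> into its
  parts is orthogonal (Moreau's decomposition for the orthant), which gives \<open>\<langle>h, h\<^sub>-\<rangle> = N\<close>, so that
  the proposed value \<open>e\<close> is the larger root of \<open>Q\<^sub>0 e\<^sup>2 + \<gamma> e - N/2\<close>.  The supremum being positive,
  some point of the orthant has positive energy, and this forces \<open>e > 0\<close>.

  For a positive root \<open>e\<close>, the gap \<open>e Q(x) + \<gamma> + \<langle>h, x\<rangle>\<close> can be written as
  \<open>(e/2) \<parallel>x + e\<^sup>-\<^sup>1 h\<^sub>-\<parallel>\<^sup>2 + \<langle>h\<^sub>+, x\<rangle>\<close>: the quadratic equation is exactly what completes the square.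
  Both summands are nonnegative on the orthant, so \<open>e\<close> bounds the energy there, and both vanish at
  \<open>x = -e\<^sup>-\<^sup>1 h\<^sub>-\<close>, which is the projection of \<open>-e\<^sup>-\<^sup>1 h\<close>.  Hence the energy attains the value \<open>e\<close>
  there, and \<open>e\<close> is the supremum.
\<close>

section \<open>Positive and negative parts and the projection onto the orthant\<close>

lemma pos_part_nth [simp]: "pos_part y $ i = max (y $ i) 0"
  by (simp add: pos_part_def)

lemma neg_part_nth [simp]: "neg_part y $ i = min (y $ i) 0"
  by (simp add: neg_part_def)

lemma pos_part_add_neg_part: "pos_part y + neg_part y = y"
  by (simp add: vec_eq_iff max_def min_def)

lemma pos_part_in_orthant: "pos_part y \<in> nonneg_orthant"
  by (simp add: nonneg_orthant_def)

lemma inner_pos_part_neg_part: "pos_part y \<bullet> neg_part y = 0"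
  unfolding inner_vec_def by (rule sum.neutral) (simp add: max_def min_def)

lemma inner_pos_part_nonneg: "x \<in> nonneg_orthant \<Longrightarrow> 0 \<le> pos_part y \<bullet> x"
  unfolding inner_vec_def by (rule sum_nonneg) (simp add: nonneg_orthant_def)

lemma inner_neg_part_nonpos: "x \<in> nonneg_orthant \<Longrightarrow> neg_part y \<bullet> x \<le> 0"
  unfolding inner_vec_def
  by (rule sum_nonpos) (simp add: nonneg_orthant_def mult_nonpos_nonneg)

lemma inner_neg_part_self: "y \<bullet> neg_part y = (norm (neg_part y))\<^sup>2"
proof -
  have "y \<bullet> neg_part y = pos_part y \<bullet> neg_part y + neg_part y \<bullet> neg_part y"
    by (metis inner_add_left pos_part_add_neg_part)
  then show ?thesis
    by (simp add: inner_pos_part_neg_part power2_norm_eq_inner)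
qed

lemma pos_part_neg_scale:
  assumes "c > 0"
  shows "pos_part (- (c *\<^sub>R h)) = - (c *\<^sub>R neg_part h)"
  using assms
  by (auto simp: vec_eq_iff max_def min_def mult_le_0_iff zero_le_mult_iff)

text \<open>
  From \<open>y\<close> the vector to the positive part is \<open>- neg_part y\<close>, which makes a nonobtuse angle with
  every direction \<open>x - pos_part y\<close> into the orthant.  The quantitative gap gives optimality and
  uniqueness at once.
\<close>

lemma norm_diff_pos_part_le:
  assumes "x \<in> nonneg_orthant"
  shows "(norm (x - pos_part y))\<^sup>2 + (norm (pos_part y - y))\<^sup>2 \<le> (norm (x - y))\<^sup>2"
proof -
  have "pos_part y - y = - neg_part y"
    using pos_part_add_neg_part[of y] by (simp add: algebra_simps)
  then have "(x - pos_part y) \<bullet> (pos_part y - y) = - (neg_part y \<bullet> x)"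
    using inner_pos_part_neg_part[of y] by (simp add: inner_diff_left inner_commute[of x])
  then have "0 \<le> (x - pos_part y) \<bullet> (pos_part y - y)"
    using inner_neg_part_nonpos[OF assms, of y] by simp
  moreover have "(norm (x - y))\<^sup>2 = (norm ((x - pos_part y) + (pos_part y - y)))\<^sup>2"
    by simp
  ultimately show ?thesis
    unfolding power2_norm_eq_inner by (simp only: inner_add_left inner_add_right inner_commute)
qed

lemma orth_proj_nonneg_orthant:
  fixes y :: "real ^ 'n"
  shows "orth_proj nonneg_orthant y = pos_part y"
  unfolding orth_proj_def arg_min_on_def
proof (rule arg_minI)
  show "pos_part y \<in> nonneg_orthant"
    by (rule pos_part_in_orthant)
next
  fix x :: "real ^ 'n" assume "x \<in> nonneg_orthant"
  then show "\<not> 1 / 2 * (norm (x - y))\<^sup>2 < 1 / 2 * (norm (pos_part y - y))\<^sup>2"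
    using norm_diff_pos_part_le[of x y] zero_le_power2[of "norm (x - pos_part y)"] by linarith
next
  fix x :: "real ^ 'n"
  assume x: "x \<in> nonneg_orthant"
    and "\<forall>z. z \<in> nonneg_orthant \<longrightarrow> \<not> 1 / 2 * (norm (z - y))\<^sup>2 < 1 / 2 * (norm (x - y))\<^sup>2"
  then have "\<not> 1 / 2 * (norm (pos_part y - y))\<^sup>2 < 1 / 2 * (norm (x - y))\<^sup>2"
    using pos_part_in_orthant[of y] by blast
  then have "(norm (x - pos_part y))\<^sup>2 \<le> 0"
    using norm_diff_pos_part_le[OF x, of y] by linarith
  then show "x = pos_part y"
    by simp
qed

section \<open>The optimal value as a root of a quadratic equation\<close>

lemma quad_pos: "Q0 > 0 \<Longrightarrow> quad Q0 x > 0"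
  by (simp add: quad_def add_nonneg_pos)

text \<open>
  The quadratic equation says that \<open>e * Q0 + \<gamma>\<close> is the constant term needed to complete the square
  in the part of the gap that involves only \<open>neg_part h\<close>.
\<close>

lemma gap_eq_square_plus_linear:
  fixes h x :: "real ^ 'n"
  assumes "e > 0" and "Q0 * e\<^sup>2 + \<gamma> * e = 1 / 2 * (norm (neg_part h))\<^sup>2"
  shows "e * quad Q0 x + \<gamma> + h \<bullet> x
    = e / 2 * (norm (x + inverse e *\<^sub>R neg_part h))\<^sup>2 + pos_part h \<bullet> x"
proof -
  have c: "e * Q0 + \<gamma> = inverse e * (neg_part h \<bullet> neg_part h) / 2"
    using assms by (simp add: power2_norm_eq_inner) (simp add: field_simps power2_eq_square)
  have "h \<bullet> x = pos_part h \<bullet> x + neg_part h \<bullet> x"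
    by (metis inner_add_left pos_part_add_neg_part)
  moreover have "e / 2 * (norm (x + inverse e *\<^sub>R neg_part h))\<^sup>2
      = e / 2 * (x \<bullet> x) + neg_part h \<bullet> x + inverse e * (neg_part h \<bullet> neg_part h) / 2"
    unfolding power2_norm_eq_inner using \<open>e > 0\<close>
    by (simp add: inner_add_left inner_add_right inner_commute field_simps)
  ultimately show ?thesis
    using c by (simp add: quad_def power2_norm_eq_inner algebra_simps)
qed

lemma energy_maximizer_of_root:
  fixes h :: "real ^ 'n"
  assumes "Q0 > 0" and "e > 0"
    and root: "Q0 * e\<^sup>2 + \<gamma> * e = 1 / 2 * (norm (neg_part h))\<^sup>2"
  defines "u \<equiv> pos_part (- (inverse e *\<^sub>R h))"
  shows "is_maximizer_on (energy Q0 \<gamma> h) nonneg_orthant u" and "energy Q0 \<gamma> h u = e"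
proof -
  note gap = gap_eq_square_plus_linear[OF \<open>e > 0\<close> root]
  have u: "u = - (inverse e *\<^sub>R neg_part h)"
    unfolding u_def using \<open>e > 0\<close> by (intro pos_part_neg_scale) simp
  have "e * quad Q0 u + \<gamma> + h \<bullet> u = 0"
    unfolding gap u by (simp add: inner_pos_part_neg_part)
  then show eq: "energy Q0 \<gamma> h u = e"
    using quad_pos[OF \<open>Q0 > 0\<close>, of u] by (simp add: energy_def field_simps)
  have "energy Q0 \<gamma> h x \<le> e" if "x \<in> nonneg_orthant" for x
  proof -
    have "0 \<le> e * quad Q0 x + \<gamma> + h \<bullet> x"
      unfolding gap using \<open>e > 0\<close> inner_pos_part_nonneg[OF that] by simp
    then show ?thesis
      using quad_pos[OF \<open>Q0 > 0\<close>, of x] by (simp add: energy_def field_simps)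
  qed
  then show "is_maximizer_on (energy Q0 \<gamma> h) nonneg_orthant u"
    unfolding is_maximizer_on_def eq by (simp add: u_def pos_part_in_orthant)
qed

text \<open>
  If \<open>neg_part h\<close> is nonzero the two roots of the quadratic have opposite signs.  If it vanishes,
  \<open>h\<close> has nonnegative inner product with the orthant, so a point of positive energy can only exist
  for \<open>\<gamma> < 0\<close>, and then the larger root is \<open>- \<gamma> / Q0\<close>.
\<close>

lemma larger_root_pos:
  fixes h x :: "real ^ 'n"
  assumes "Q0 > 0" and x: "x \<in> nonneg_orthant" and "energy Q0 \<gamma> h x > 0"
  shows "0 < (- \<gamma> + sqrt (\<gamma>\<^sup>2 + 2 * Q0 * (norm (neg_part h))\<^sup>2)) / (2 * Q0)"
proof -
  have "\<gamma> < sqrt (\<gamma>\<^sup>2 + 2 * Q0 * (norm (neg_part h))\<^sup>2)"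
  proof (cases "neg_part h = 0")
    case True
    then have "pos_part h = h"
      using pos_part_add_neg_part[of h] by simp
    then have "0 \<le> h \<bullet> x"
      using inner_pos_part_nonneg[OF x, of h] by simp
    moreover have "\<gamma> + h \<bullet> x < 0"
      using assms(3) quad_pos[OF \<open>Q0 > 0\<close>, of x]
      by (simp add: energy_def divide_less_0_iff)
    ultimately show ?thesis
      using True by simp
  next
    case False
    then have "\<gamma>\<^sup>2 < \<gamma>\<^sup>2 + 2 * Q0 * (norm (neg_part h))\<^sup>2"
      using \<open>Q0 > 0\<close> by simp
    then show ?thesis
      by (rule real_less_rsqrt)
  qed
  then show ?thesis
    using \<open>Q0 > 0\<close> by simp
qed

lemma larger_root_satisfies:
  fixes a b c :: real
  assumes "a \<noteq> 0" and "0 \<le> b\<^sup>2 + 2 * a * c"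
    and e: "e = (- b + sqrt (b\<^sup>2 + 2 * a * c)) / (2 * a)"
  shows "a * e\<^sup>2 + b * e = 1 / 2 * c"
proof -
  have "2 * a * e + b = sqrt (b\<^sup>2 + 2 * a * c)"
    using \<open>a \<noteq> 0\<close> by (simp add: e)
  then have "(2 * a * e + b)\<^sup>2 = b\<^sup>2 + 2 * a * c"
    using assms(2) by simp
  then have "4 * a * (a * e\<^sup>2 + b * e) = 4 * a * (1 / 2 * c)"
    by (simp add: power2_eq_square algebra_simps)
  then show ?thesis
    using \<open>a \<noteq> 0\<close> by (simp only: mult_cancel_left) simp
qed

section \<open>Solution of the problem\<close>

theorem proposition3p4:
  fixes \<gamma> Q0 :: real and h :: "real ^ 'n"
  assumes "Q0 > 0"
    and "(SUP x\<in>nonneg_orthant. energy Q0 \<gamma> h x) > 0"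
  shows "(\<forall>y :: real ^ 'n. orth_proj nonneg_orthant y = pos_part y) \<and>
        (let e = (SUP x\<in>nonneg_orthant. energy Q0 \<gamma> h x);
             u = orth_proj nonneg_orthant (- (inverse e *\<^sub>R h));
             \<beta>\<^sub>1 = Q0;
             \<beta>\<^sub>2 = \<gamma>;
             \<beta>\<^sub>3 = 1 / 2 * (norm (neg_part h))\<^sup>2 - h \<bullet> neg_part h
         in is_maximizer_on (energy Q0 \<gamma> h) nonneg_orthant u
            \<and> e = energy Q0 \<gamma> h u
            \<and> e = (- \<beta>\<^sub>2 + sqrt (\<beta>\<^sub>2\<^sup>2 - 4 * \<beta>\<^sub>1 * \<beta>\<^sub>3)) / (2 * \<beta>\<^sub>1))"
proof -
  define r where "r = (- \<gamma> + sqrt (\<gamma>\<^sup>2 + 2 * Q0 * (norm (neg_part h))\<^sup>2)) / (2 * Q0)"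
  define u where "u = pos_part (- (inverse r *\<^sub>R h))"
  have "\<exists>x\<in>nonneg_orthant. 0 < energy Q0 \<gamma> h x"
  proof (rule ccontr)
    assume "\<not> ?thesis"
    then have "(SUP x\<in>nonneg_orthant. energy Q0 \<gamma> h x) \<le> 0"
      using pos_part_in_orthant by (intro cSUP_least) (auto simp: not_less)
    then show False
      using assms(2) by simp
  qed
  then have "r > 0"
    unfolding r_def using larger_root_pos[OF \<open>Q0 > 0\<close>] by blast
  have root: "Q0 * r\<^sup>2 + \<gamma> * r = 1 / 2 * (norm (neg_part h))\<^sup>2"
    using \<open>Q0 > 0\<close> by (intro larger_root_satisfies[OF _ _ r_def]) auto
  have max: "is_maximizer_on (energy Q0 \<gamma> h) nonneg_orthant u" and val: "energy Q0 \<gamma> h u = r"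
    using energy_maximizer_of_root[OF \<open>Q0 > 0\<close> \<open>r > 0\<close> root] by (simp_all add: u_def)
  have sup: "(SUP x\<in>nonneg_orthant. energy Q0 \<gamma> h x) = r"
    using max val by (intro cSup_eq_maximum) (auto simp: is_maximizer_on_def)
  have "\<gamma>\<^sup>2 - 4 * Q0 * (1 / 2 * (norm (neg_part h))\<^sup>2 - h \<bullet> neg_part h)
      = \<gamma>\<^sup>2 + 2 * Q0 * (norm (neg_part h))\<^sup>2"
    by (simp add: inner_neg_part_self algebra_simps)
  then show ?thesis
    using max val
    unfolding Let_def sup orth_proj_nonneg_orthant u_def[symmetric] by (simp add: r_def)
qed

end
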